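(* Let $c\in\mathbb{R}$, let $c_n=(-1)^n c$ for $n\ge 1$, and let $\{d_n\}_{n=1}^{\infty}$ be a positive chain sequence. Let $\mu$ be the probability measure on the unit circle associated with the pair of sequences $\{\{c_n\}_{n=1}^{\infty},\{d_n\}_{n=1}^{\infty}\}$. Then the support of $\mu$ lies within $\mathcal{C}_1\cup\mathcal{C}_2$, where $$\mathcal{C}_1=\{z\in\mathbb{T}: 0\le \arg(z)\le \theta_c\},\qquad \mathcal{C}_2=\{z\in\mathbb{T}: 2\pi-\theta_c\le \arg(z)\le 2\pi\},\qquad \theta_c=\arccos\left(\frac{c^2-1}{c^2+1}\right)\in[0,\pi].$$
   Context: $\mathbb{T}=\{z\in\mathbb{C}:|z|=1\}$, and the argument of a point of $\mathbb{T}$ is taken in $[0,2\pi]$ (with $z=1$ having arguments $0$ and $2\pi$). A real sequence $\{d_n\}_{n=1}^\infty$ is a positive chain sequence if there is a sequence $\{g_n\}_{n=0}^\infty$ (a parameter sequence) with $0\le g_0<1$, $0<g_n<1$ for $n\ge1$, and $d_n=(1-g_{n-1})g_n$ for $n\ge1$. The minimal parameter sequence $\{m_n\}_{n=0}^\infty$ is the one with $m_0=0$. For a nontrivial probability measure $\mu$ on $\mathbb{T}$ (infinite support) with monic orthogonal polynomials $\phi_n$, the Verblunsky coefficients are $\alpha_{n-1}=-\overline{\phi_n(0)}$, $n\ge1$; every sequence $\{\alpha_n\}_{n\ge0}$ with $|\alpha_n|<1$ is the Verblunsky sequence of exactly one nontrivial probability measure on $\mathbb{T}$. The measure associated with a pair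 $\{\{c_n\}_{n=1}^\infty,\{d_n\}_{n=1}^\infty\}$, where $\{c_n\}$ is real and $\{d_n\}$ is a positive chain sequence with minimal parameter sequence $\{m_n\}$, is the unique nontrivial probability measure on $\mathbb{T}$ with Verblunsky coefficients $$\alpha_{n-1}=\overline{\tau}_{n-1}\,\frac{1-2m_n-ic_n}{1-ic_n},\quad n\ge1,\qquad \tau_0=1,\quad \tau_n=\prod_{k=1}^n\frac{1-ic_k}{1+ic_k}.$$ *)

theory Defs
  imports
    "HOL-Probability.Probability"
    "HOL-Computational_Algebra.Polynomial"
begin

text \<open>The sequences \<open>c\<close> and \<open>d\<close> start at index 1; the values \<open>c 0\<close> and \<open>d 0\<close> are never used.\<close>

definition parameter_sequence :: "(nat \<Rightarrow> real) \<Rightarrow> (nat \<Rightarrow> real) \<Rightarrow> bool" where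
  "parameter_sequence d g \<longleftrightarrow>
     0 \<le> g 0 \<and> g 0 < 1 \<and>
     (\<forall>n\<ge>1. 0 < g n \<and> g n < 1) \<and>
     (\<forall>n\<ge>1. d n = (1 - g (n - 1)) * g n)"

definition positive_chain_sequence :: "(nat \<Rightarrow> real) \<Rightarrow> bool" where
  "positive_chain_sequence d \<longleftrightarrow> (\<exists>g. parameter_sequence d g)"

definition minimal_parameters :: "(nat \<Rightarrow> real) \<Rightarrow> nat \<Rightarrow> real" where
  "minimal_parameters d = (THE m. parameter_sequence d m \<and> m 0 = 0)"

abbreviation unit_circle :: "complex set" where
  "unit_circle \<equiv> sphere 0 1"

definition measure_support :: "complex measure \<Rightarrow> complex set" where
  "measure_support \<mu> =
     {z \<in> space \<mu>. \<forall>U. open U \<and> z \<in> U \<longrightarrow> emeasure \<mu> (U \<inter> space \<mu>) > 0}"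

definition nontrivial_prob_measure :: "complex measure \<Rightarrow> bool" where
  "nontrivial_prob_measure \<mu> \<longleftrightarrow>
     sets \<mu> = sets (restrict_space borel unit_circle) \<and>
     prob_space \<mu> \<and>
     infinite (measure_support \<mu>)"

definition monic_orthogonal_poly :: "complex measure \<Rightarrow> nat \<Rightarrow> complex poly" where
  "monic_orthogonal_poly \<mu> n =
     (THE p. degree p = n \<and> lead_coeff p = 1 \<and>
        (\<forall>q. degree q < n \<longrightarrow> (LINT z|\<mu>. cnj (poly q z) * poly p z) = 0))"

definition verblunsky :: "complex measure \<Rightarrow> nat \<Rightarrow> complex" where
  "verblunsky \<mu> n = - cnj (poly (monic_orthogonal_poly \<mu> (Suc n)) 0)"

definition tau :: "(nat \<Rightarrow> real) \<Rightarrow> nat \<Rightarrow> complex" where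
  "tau c n = (\<Prod>k=1..n. (1 - \<i> * of_real (c k)) / (1 + \<i> * of_real (c k)))"

text \<open>By Verblunsky's theorem exactly one measure satisfies this predicate when \<open>d\<close> is a
  positive chain sequence.\<close>

definition associated_measure ::
  "(nat \<Rightarrow> real) \<Rightarrow> (nat \<Rightarrow> real) \<Rightarrow> complex measure \<Rightarrow> bool" where
  "associated_measure c d \<mu> \<longleftrightarrow>
     nontrivial_prob_measure \<mu> \<and>
     (\<forall>n\<ge>1. verblunsky \<mu> (n - 1) =
        cnj (tau c (n - 1)) *
        ((1 - 2 * of_real (minimal_parameters d n) - \<i> * of_real (c n)) /
         (1 - \<i> * of_real (c n))))"

definition theta :: "real \<Rightarrow> real" where
  "theta c = arccos ((c\<^sup>2 - 1) / (c\<^sup>2 + 1))"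

text \<open>The argument is read as a multi-valued relation with values in \<open>[0, 2\<pi>]\<close>, so that the
  point 1 has both arguments \<open>0\<close> and \<open>2\<pi>\<close>; \<^const>\<open>Arg2pi\<close> would only give the former.\<close>

definition arc1 :: "real \<Rightarrow> complex set" where
  "arc1 c = {z \<in> unit_circle. \<exists>t. is_Arg z t \<and> 0 \<le> t \<and> t \<le> theta c}"

definition arc2 :: "real \<Rightarrow> complex set" where
  "arc2 c = {z \<in> unit_circle. \<exists>t. is_Arg z t \<and> 2 * pi - theta c \<le> t \<and> t \<le> 2 * pi}"

end

theory Submission
  imports Defs
begin

text \<open>
  Let \<open>s = sqrt (1 + c\<^sup>2)\<close>. A point \<open>z\<close> of the circle lies in one of the two arcs exactly when
  \<open>Re z \<ge> (c\<^sup>2 - 1) / (c\<^sup>2 + 1)\<close>, which is the same as \<open>\<bar>1 + z\<bar>\<^sup>2 \<ge> \<kappa>\<^sup>2\<close> with \<open>\<kappa> = 2 * c / s\<close>.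
  So it suffices that multiplication by \<open>1 + z\<close> enlarges the \<open>L\<^sup>2(\<mu>)\<close> norm of every polynomial
  at least by the factor \<open>\<bar>\<kappa>\<bar>\<close>. Indeed, testing this with high powers of \<open>1 + cnj w * z\<close>, whose
  modulus on the circle peaks at \<open>w\<close>, excludes from the support every \<open>w\<close> with
  \<open>\<bar>1 + w\<bar> < \<bar>\<kappa>\<bar>\<close> (lemma \<open>support_subset_half_plane\<close>).

  The norm inequality comes from the CMV representation. The recursion of Szego yields an
  orthonormal family \<open>x\<^sub>n\<close> of Laurent polynomials such that \<open>cnj x\<^sub>n\<close> and \<open>cnj z * cnj x\<^sub>n\<close> are
  combinations of \<open>x\<^sub>n\<close> and one neighbour: the two families of coefficients are the block
  diagonal factors of the CMV matrix. Their sum, which represents \<open>f \<mapsto> (1 + cnj z) * cnj f\<close>,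
  is tridiagonal with real off-diagonal entries, and its diagonal entries are
  \<open>\<alpha>\<^sub>n - \<alpha>\<^sub>n\<^sub>-\<^sub>1\<close> for even \<open>n\<close> and the conjugate of that for odd \<open>n\<close>.

  For \<open>c\<^sub>n = (-1)\<^sup>n c\<close> the Verblunsky coefficients are
  \<open>\<alpha>\<^sub>n = (1 - 2 * m\<^sub>n\<^sub>+\<^sub>1 + \<i> * (-1)\<^sup>n * c) / (1 + \<i> * c)\<close>. With \<open>\<epsilon>\<^sup>2 = (1 + \<i> * c) / s\<close> the numbers
  \<open>\<epsilon>\<^sup>2 * \<alpha>\<^sub>n\<close> have the imaginary part \<open>(-1)\<^sup>n * \<kappa> / 2\<close>; the \<open>m\<^sub>n\<close> enter the real part. Multiplying
  \<open>x\<^sub>n\<close> alternately by \<open>cnj \<epsilon>\<close> and \<open>\<epsilon>\<close> therefore turns the tridiagonal matrix into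
  \<open>J + \<i> * \<kappa>\<close> with \<open>J\<close> real and symmetric, and
  \<open>\<parallel>(J + \<i> * \<kappa>) h\<parallel>\<^sup>2 = \<parallel>J h\<parallel>\<^sup>2 + \<kappa>\<^sup>2 * \<parallel>h\<parallel>\<^sup>2\<close> because the cross term vanishes
  (lemma \<open>shifted_tridiagonal_bound\<close>, theorem \<open>verblunsky_spectral_gap\<close>).
\<close>

section \<open>Orthogonality on the unit circle\<close>

lemma cnj_mult_self_circle: "cmod z = 1 \<Longrightarrow> cnj z * z = 1" "cmod z = 1 \<Longrightarrow> z * cnj z = 1"
  by (simp_all add: mult.commute complex_norm_square[symmetric])

text \<open>The polynomial usually written \<open>p\<^sup>*\<close>; its order of reversal is the actual degree of \<open>p\<close>.\<close>

definition conj_reversal :: "complex poly \<Rightarrow> complex poly" where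
  "conj_reversal p = reflect_poly (map_poly cnj p)"

lemma poly_conj_reversal:
  assumes "cmod z = 1"
  shows "poly (conj_reversal p) z = z ^ degree p * cnj (poly p z)"
proof -
  have z0: "z \<noteq> 0" using assms by auto
  have iz: "cnj (inverse z) = z"
    using cnj_mult_self_circle(2)[OF assms] z0 by (metis complex_cnj_cnj inverse_unique)
  have "degree (map_poly cnj p) = degree p" by (rule degree_map_poly) auto
  then show ?thesis unfolding conj_reversal_def using z0 iz
    by (simp add: poly_reflect_poly_nz)
qed

lemma poly_conj_reversal_0: "poly (conj_reversal p) 0 = cnj (lead_coeff p)"
  by (simp add: conj_reversal_def coeff_map_poly degree_map_poly)

lemma degree_conj_reversal_le: "degree (conj_reversal p) \<le> degree p"
  using degree_reflect_poly_le[of "map_poly cnj p"]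
  by (simp add: conj_reversal_def degree_map_poly)

locale circle_measure =
  fixes \<mu> :: "complex measure"
  assumes nontrivial: "nontrivial_prob_measure \<mu>"
begin

sublocale prob_space \<mu>
  using nontrivial by (simp add: nontrivial_prob_measure_def)

lemma sets_circle: "sets \<mu> = sets (restrict_space borel unit_circle)"
  using nontrivial by (simp add: nontrivial_prob_measure_def)

lemma space_circle: "space \<mu> = unit_circle"
  using sets_eq_imp_space_eq[OF sets_circle] by (simp add: space_restrict_space)

lemma measurable_continuous:
  fixes f :: "complex \<Rightarrow> 'b :: topological_space"
  assumes "continuous_on unit_circle f"
  shows "f \<in> borel_measurable \<mu>"
  using borel_measurable_continuous_on_restrict[OF assms] sets_circle
  by (metis measurable_cong_sets)

lemma integrable_continuous:
  fixes f :: "complex \<Rightarrow> 'b :: {banach, second_countable_topology}"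
  assumes "continuous_on unit_circle f"
  shows "integrable \<mu> f"
proof -
  have "bounded (f ` unit_circle)"
    by (intro compact_imp_bounded compact_continuous_image assms compact_sphere)
  then obtain B where "\<And>z. z \<in> unit_circle \<Longrightarrow> norm (f z) \<le> B"
    unfolding bounded_iff by blast
  then show ?thesis
    by (intro integrable_const_bound[where B = B] measurable_continuous assms AE_I2)
       (auto simp: space_circle)
qed

lemma integral_circle_cong:
  assumes "\<And>z. cmod z = 1 \<Longrightarrow> f z = g z"
  shows "integral\<^sup>L \<mu> f = integral\<^sup>L \<mu> g"
  using assms by (intro Bochner_Integration.integral_cong) (auto simp: space_circle)

definition ip :: "(complex \<Rightarrow> complex) \<Rightarrow> (complex \<Rightarrow> complex) \<Rightarrow> complex" where
  "ip f g = (LINT z|\<mu>. f z * cnj (g z))"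

lemma ip_cong:
  assumes "\<And>z. cmod z = 1 \<Longrightarrow> f z * cnj (g z) = f' z * cnj (g' z)"
  shows "ip f g = ip f' g'"
  unfolding ip_def by (rule integral_circle_cong) (rule assms)

lemma ip_commute: "ip g f = cnj (ip f g)"
  unfolding ip_def Bochner_Integration.integral_cnj[symmetric] by (simp add: mult.commute)

lemma ip_sum_left:
  assumes "\<And>i. i \<in> A \<Longrightarrow> continuous_on unit_circle (f i)" "continuous_on unit_circle g"
  shows "ip (\<lambda>z. \<Sum>i\<in>A. c i * f i z) g = (\<Sum>i\<in>A. c i * ip (f i) g)"
proof -
  have "integrable \<mu> (\<lambda>z. c i * (f i z * cnj (g z)))" if "i \<in> A" for i
    using assms that by (intro integrable_continuous continuous_intros) auto
  then show ?thesis
    unfolding ip_def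
    by (simp add: sum_distrib_right mult.assoc Bochner_Integration.integral_sum)
qed

lemma ip_sum_right:
  assumes "\<And>i. i \<in> A \<Longrightarrow> continuous_on unit_circle (f i)" "continuous_on unit_circle g"
  shows "ip g (\<lambda>z. \<Sum>i\<in>A. c i * f i z) = (\<Sum>i\<in>A. cnj (c i) * ip g (f i))"
  by (subst ip_commute, subst ip_sum_left)
     (use assms in \<open>auto simp: ip_commute[symmetric]\<close>)

lemma ip_diff_left:
  assumes "continuous_on unit_circle f" "continuous_on unit_circle g" "continuous_on unit_circle h"
  shows "ip (\<lambda>z. f z - a * g z) h = ip f h - a * ip g h"
proof -
  have "integrable \<mu> (\<lambda>z. f z * cnj (h z))" "integrable \<mu> (\<lambda>z. g z * cnj (h z))"
    using assms by (intro integrable_continuous continuous_intros; simp)+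
  then show ?thesis unfolding ip_def by (simp add: left_diff_distrib mult.assoc)
qed

lemma ip_self: "ip f f = of_real (LINT z|\<mu>. (cmod (f z))\<^sup>2)"
  unfolding ip_def integral_complex_of_real[symmetric]
  by (simp add: complex_norm_square[symmetric])

text \<open>A polynomial of norm zero vanishes \<open>\<mu>\<close>-almost everywhere, hence, being continuous, on the whole
  support, which is infinite.\<close>

lemma sqnorm_poly_pos:
  assumes "p \<noteq> 0"
  shows "(LINT z|\<mu>. (cmod (poly p z))\<^sup>2) > 0"
proof (rule ccontr)
  let ?f = "\<lambda>z. (cmod (poly p z))\<^sup>2"
  assume "\<not> ?thesis"
  moreover have "(LINT z|\<mu>. ?f z) \<ge> 0" by simp
  ultimately have "(LINT z|\<mu>. ?f z) = 0" by linarith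
  moreover have "integrable \<mu> ?f" by (intro integrable_continuous continuous_intros)
  ultimately have "AE z in \<mu>. ?f z = 0"
    using integral_nonneg_eq_0_iff_AE[of \<mu> ?f] by auto
  then have ae: "AE z in \<mu>. poly p z = 0" by simp
  have "measure_support \<mu> \<subseteq> {z. poly p z = 0}"
  proof (rule ccontr)
    assume "\<not> ?thesis"
    then obtain z where z: "z \<in> measure_support \<mu>" "poly p z \<noteq> 0" by auto
    let ?U = "{w. poly p w \<noteq> 0}"
    have "open ?U" by (intro open_Collect_neq continuous_intros)
    then have "emeasure \<mu> (?U \<inter> space \<mu>) > 0"
      using z unfolding measure_support_def by auto
    moreover have "?U \<inter> space \<mu> = {w \<in> space \<mu>. poly p w \<noteq> 0}" by auto
    moreover have "emeasure \<mu> {w \<in> space \<mu>. poly p w \<noteq> 0} = 0"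
      using ae by (intro emeasure_eq_0_AE) simp
    ultimately show False by simp
  qed
  then have "finite (measure_support \<mu>)"
    using poly_roots_finite[OF assms] finite_subset by blast
  then show False using nontrivial by (simp add: nontrivial_prob_measure_def)
qed

section \<open>The recursion of Szego\<close>

text \<open>Orthogonality is tested on monomials, since multiplication by \<open>z\<close> and conjugate reversal act on
  them by shifting and reflecting the exponent.\<close>

definition monic_orthogonal :: "nat \<Rightarrow> complex poly \<Rightarrow> bool" where
  "monic_orthogonal n p \<longleftrightarrow>
     degree p = n \<and> lead_coeff p = 1 \<and> (\<forall>i<n. ip (poly p) (\<lambda>z. z ^ i) = 0)"

lemma ip_poly_right:
  assumes "continuous_on unit_circle f"
  shows "ip f (poly q) = (\<Sum>i\<le>degree q. cnj (coeff q i) * ip f (\<lambda>z. z ^ i))"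
  unfolding poly_altdef[of q] by (intro ip_sum_right continuous_intros assms)

lemma ip_lower_degree:
  assumes "monic_orthogonal n p" "degree q < n"
  shows "ip (poly p) (poly q) = 0"
proof -
  have "ip (poly p) (poly q) = (\<Sum>i\<le>degree q. cnj (coeff q i) * ip (poly p) (\<lambda>z. z ^ i))"
    by (intro ip_poly_right continuous_intros)
  also have "\<dots> = 0"
    using assms by (intro sum.neutral) (auto simp: monic_orthogonal_def)
  finally show ?thesis .
qed

lemma monic_orthogonal_iff:
  "monic_orthogonal n p \<longleftrightarrow> degree p = n \<and> lead_coeff p = 1 \<and>
     (\<forall>q. degree q < n \<longrightarrow> (LINT z|\<mu>. cnj (poly q z) * poly p z) = 0)"
  (is "_ \<longleftrightarrow> ?R")
proof
  assume "monic_orthogonal n p"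
  then show ?R using ip_lower_degree[of n p]
    by (auto simp: monic_orthogonal_def ip_def mult.commute)
next
  assume R: ?R
  have "ip (poly p) (\<lambda>z. z ^ i) = 0" if "i < n" for i
    using R[THEN conjunct2, THEN conjunct2, rule_format, of "monom 1 i"] that
    by (simp add: degree_monom_eq poly_monom ip_def mult.commute)
  then show "monic_orthogonal n p" using R by (auto simp: monic_orthogonal_def)
qed

lemma monic_orthogonal_unique:
  assumes "monic_orthogonal n p" "monic_orthogonal n p'"
  shows "p = p'"
proof (rule ccontr)
  assume "p \<noteq> p'"
  define q where "q = p - p'"
  have q0: "q \<noteq> 0" using \<open>p \<noteq> p'\<close> by (simp add: q_def)
  have "coeff q n = 0" "degree q \<le> n"
    using assms by (auto simp: q_def monic_orthogonal_def intro: degree_diff_le)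
  then have "degree q < n" using q0 by (metis le_neq_implies_less leading_coeff_0_iff)
  moreover have "ip (poly q) (poly q) = ip (poly p) (poly q) - 1 * ip (poly p') (poly q)"
    by (subst ip_diff_left[symmetric])
       (auto intro!: continuous_intros ip_cong simp: q_def)
  ultimately have "ip (poly q) (poly q) = 0" using ip_lower_degree assms by simp
  then show False using sqnorm_poly_pos[OF q0] by (simp add: ip_self)
qed

text \<open>On the circle reversal is \<open>p \<mapsto> z\<^sup>n * cnj p\<close>, so it reflects the exponent \<open>i\<close> to \<open>n - i\<close> and the
  orthogonality to \<open>1, \<dots>, z\<^sup>n\<^sup>-\<^sup>1\<close> becomes one to \<open>z, \<dots>, z\<^sup>n\<close>.\<close>

lemma ip_conj_reversal:
  assumes "monic_orthogonal n p" "0 < i" "i \<le> n"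
  shows "ip (poly (conj_reversal p)) (\<lambda>z. z ^ i) = 0"
proof -
  have "ip (poly (conj_reversal p)) (\<lambda>z. z ^ i) = ip (\<lambda>z. z ^ (n - i)) (poly p)"
  proof (rule ip_cong)
    fix z :: complex assume z: "cmod z = 1"
    have "z ^ n * cnj (z ^ i) = z ^ (n - i) * (z * cnj z) ^ i"
      using \<open>i \<le> n\<close> by (simp add: power_mult_distrib power_add[symmetric])
    then have "z ^ n * cnj (z ^ i) = z ^ (n - i)"
      by (simp add: cnj_mult_self_circle z)
    then show "poly (conj_reversal p) z * cnj (z ^ i) = z ^ (n - i) * cnj (poly p z)"
      using assms(1) z by (simp add: poly_conj_reversal monic_orthogonal_def)
  qed
  also have "\<dots> = cnj (ip (poly p) (\<lambda>z. z ^ (n - i)))" by (rule ip_commute)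
  also have "\<dots> = 0" using assms by (simp add: monic_orthogonal_def)
  finally show ?thesis .
qed

text \<open>Both sides equal the inner product of \<open>p\<close> with \<open>z\<^sup>n\<close>, its only monomial not orthogonal to \<open>p\<close>.\<close>

lemma ip_conj_reversal_1:
  assumes "monic_orthogonal n p"
  shows "ip (poly (conj_reversal p)) (\<lambda>z. 1) = ip (poly p) (poly p)"
proof -
  have "ip (poly p) (poly p) = (\<Sum>i\<le>n. cnj (coeff p i) * ip (poly p) (\<lambda>z. z ^ i))"
    using assms(1) ip_poly_right[of "poly p" p, OF continuous_on_poly[OF continuous_on_id]]
    by (auto simp: monic_orthogonal_def)
  also have "\<dots> = (\<Sum>i\<in>{n}. cnj (coeff p i) * ip (poly p) (\<lambda>z. z ^ i))"
    using assms by (intro sum.mono_neutral_right) (auto simp: monic_orthogonal_def)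
  also have "\<dots> = ip (poly p) (\<lambda>z. z ^ n)" using assms by (auto simp: monic_orthogonal_def)
  finally have "ip (poly p) (poly p) = cnj (ip (\<lambda>z. z ^ n) (poly p))"
    by (simp add: ip_commute[of "\<lambda>z. z ^ n"])
  also have "ip (\<lambda>z. z ^ n) (poly p) = ip (poly (conj_reversal p)) (\<lambda>z. 1)"
    using assms by (intro ip_cong) (simp add: poly_conj_reversal monic_orthogonal_def)
  finally have "ip (poly (conj_reversal p)) (\<lambda>z. 1) = cnj (ip (poly p) (poly p))" by simp
  then show ?thesis by (simp add: ip_self)
qed

text \<open>Multiplication by \<open>z\<close> keeps the orthogonality to \<open>z, \<dots>, z\<^sup>n\<close> and can only lose the one to \<open>1\<close>.
  The reversed polynomial is orthogonal to \<open>z, \<dots>, z\<^sup>n\<close> and not to \<open>1\<close>, so a multiple of it repairs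
  this. The step gives both the existence of the orthogonal polynomials and their recursion.\<close>

lemma monic_orthogonal_step:
  assumes "monic_orthogonal n p"
  defines "a \<equiv> ip (poly (pCons 0 p)) (\<lambda>z. 1) / ip (poly p) (poly p)"
  shows "monic_orthogonal (Suc n) (pCons 0 p - smult a (conj_reversal p))"
proof -
  let ?q = "pCons 0 p - smult a (conj_reversal p)"
  have p: "degree p = n" "coeff p n = 1" "p \<noteq> 0" using assms by (auto simp: monic_orthogonal_def)
  have pp: "ip (poly p) (poly p) \<noteq> 0"
    using sqnorm_poly_pos[OF p(3)] by (simp add: ip_self)
  have rev: "degree (conj_reversal p) \<le> n" using degree_conj_reversal_le p by metis
  have "coeff (conj_reversal p) (Suc n) = 0" using rev by (intro coeff_eq_0) auto
  then have lead: "coeff ?q (Suc n) = 1" using p by simp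
  have "degree ?q \<le> Suc n"
    using p rev by (intro degree_diff_le order.trans[OF degree_smult_le]) auto
  then have deg: "degree ?q = Suc n"
    using lead by (metis le_antisym le_degree one_neq_zero)
  have split: "ip (poly ?q) (\<lambda>z. z ^ i) = ip (poly (pCons 0 p)) (\<lambda>z. z ^ i)
      - a * ip (poly (conj_reversal p)) (\<lambda>z. z ^ i)" for i
    by (subst ip_diff_left[symmetric]) (auto intro!: continuous_intros ip_cong)
  have "ip (poly ?q) (\<lambda>z. z ^ i) = 0" if "i < Suc n" for i
  proof (cases i)
    case 0
    then show ?thesis
      unfolding split using ip_conj_reversal_1[OF assms(1)] pp by (simp add: a_def)
  next
    case (Suc j)
    have "ip (poly (pCons 0 p)) (\<lambda>z. z ^ i) = ip (poly p) (\<lambda>z. z ^ j)"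
    proof (rule ip_cong)
      fix z :: complex assume z: "cmod z = 1"
      have "poly (pCons 0 p) z * cnj (z ^ i) = (z * cnj z) * (poly p z * cnj (z ^ j))"
        by (simp add: Suc ac_simps)
      then show "poly (pCons 0 p) z * cnj (z ^ i) = poly p z * cnj (z ^ j)"
        by (simp add: cnj_mult_self_circle z)
    qed
    also have "\<dots> = 0" using assms that Suc by (simp add: monic_orthogonal_def)
    finally show ?thesis
      unfolding split using ip_conj_reversal[OF assms(1), of i] that Suc by simp
  qed
  then show ?thesis using deg lead by (simp add: monic_orthogonal_def)
qed

abbreviation \<Phi> :: "nat \<Rightarrow> complex poly" where
  "\<Phi> \<equiv> monic_orthogonal_poly \<mu>"

lemma monic_orthogonal_poly_eqI: "monic_orthogonal n p \<Longrightarrow> \<Phi> n = p"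
  unfolding monic_orthogonal_poly_def
  by (rule the_equality) (auto simp: monic_orthogonal_iff[symmetric] monic_orthogonal_unique)

lemma monic_orthogonal_\<Phi>: "monic_orthogonal n (\<Phi> n)"
proof -
  have "\<exists>p. monic_orthogonal n p"
  proof (induction n)
    case 0
    then show ?case by (intro exI[of _ 1]) (simp add: monic_orthogonal_def)
  next
    case (Suc n)
    then show ?case using monic_orthogonal_step by blast
  qed
  then show ?thesis using monic_orthogonal_poly_eqI by blast
qed

lemma degree_\<Phi>: "degree (\<Phi> n) = n" and lead_coeff_\<Phi>: "lead_coeff (\<Phi> n) = 1"
  and \<Phi>_nonzero: "\<Phi> n \<noteq> 0"
  using monic_orthogonal_\<Phi>[of n] by (auto simp: monic_orthogonal_def)

text \<open>The correction coefficient is identified by evaluation at \<open>0\<close>, where the reversed polynomial is \<open>1\<close>.\<close>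

theorem szego_recursion:
  "\<Phi> (Suc n) = pCons 0 (\<Phi> n) - smult (cnj (verblunsky \<mu> n)) (conj_reversal (\<Phi> n))"
proof -
  obtain a where a: "\<Phi> (Suc n) = pCons 0 (\<Phi> n) - smult a (conj_reversal (\<Phi> n))"
    using monic_orthogonal_poly_eqI[OF monic_orthogonal_step[OF monic_orthogonal_\<Phi>]] by blast
  then have "poly (\<Phi> (Suc n)) 0 = - a"
    using lead_coeff_\<Phi>[of n] by (simp add: poly_conj_reversal_0)
  then have "a = cnj (verblunsky \<mu> n)" by (simp add: verblunsky_def)
  then show ?thesis using a by simp
qed

section \<open>Normalised polynomials\<close>

definition poly_norm :: "nat \<Rightarrow> real" where
  "poly_norm n = sqrt (LINT z|\<mu>. (cmod (poly (\<Phi> n) z))\<^sup>2)"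

definition \<phi> :: "nat \<Rightarrow> complex \<Rightarrow> complex" where
  "\<phi> n z = poly (\<Phi> n) z / poly_norm n"

definition \<phi>s :: "nat \<Rightarrow> complex \<Rightarrow> complex" where
  "\<phi>s n z = poly (conj_reversal (\<Phi> n)) z / poly_norm n"

text \<open>The number \<open>sqrt (1 - \<bar>\<alpha>\<^sub>n\<bar>\<^sup>2)\<close>, see lemma \<open>\<rho>_\<alpha>\<close>.\<close>

definition \<rho> :: "nat \<Rightarrow> real" where
  "\<rho> n = poly_norm (Suc n) / poly_norm n"

abbreviation \<alpha> :: "nat \<Rightarrow> complex" where
  "\<alpha> \<equiv> verblunsky \<mu>"

lemma poly_norm_pos: "poly_norm n > 0"
  using sqnorm_poly_pos[OF \<Phi>_nonzero] by (simp add: poly_norm_def)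

lemma \<rho>_pos: "\<rho> n > 0"
  by (simp add: \<rho>_def poly_norm_pos)

lemma \<phi>_0: "\<phi> 0 z = 1"
proof -
  have "monic_orthogonal 0 1" by (simp add: monic_orthogonal_def)
  then have "\<Phi> 0 = 1" by (rule monic_orthogonal_poly_eqI)
  then show ?thesis by (simp add: \<phi>_def poly_norm_def prob_space)
qed

lemma continuous_\<phi> [continuous_intros]: "continuous_on A (\<phi> n)" "continuous_on A (\<phi>s n)"
  unfolding \<phi>_def[abs_def] \<phi>s_def[abs_def] divide_inverse by (intro continuous_intros)+

lemma \<phi>s_circle: "cmod z = 1 \<Longrightarrow> \<phi>s n z = z ^ n * cnj (\<phi> n z)"
  by (simp add: \<phi>s_def \<phi>_def poly_conj_reversal degree_\<Phi>)

lemma power_mult_cnj_power: "cmod z = 1 \<Longrightarrow> z ^ n * (cnj z ^ n * w) = w"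
  by (simp add: mult.assoc[symmetric] power_mult_distrib[symmetric] cnj_mult_self_circle)

lemma \<phi>_circle: "cmod z = 1 \<Longrightarrow> \<phi> n z = z ^ n * cnj (\<phi>s n z)"
  by (simp add: \<phi>s_circle power_mult_cnj_power)

lemma ip_\<phi>_lower: "degree q < n \<Longrightarrow> ip (\<phi> n) (poly q) = 0"
  using ip_lower_degree[OF monic_orthogonal_\<Phi>, of q n]
  by (simp add: \<phi>_def[abs_def] ip_def)

lemma ip_\<phi>s_lower:
  assumes "degree q < n"
  shows "ip (\<phi>s n) (\<lambda>z. z * poly q z) = 0"
proof -
  have "ip (poly (conj_reversal (\<Phi> n))) (poly (pCons 0 q)) = 0"
  proof (subst ip_poly_right)
    show "(\<Sum>i\<le>degree (pCons 0 q). cnj (coeff (pCons 0 q) i) *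
        ip (poly (conj_reversal (\<Phi> n))) (\<lambda>z. z ^ i)) = 0"
    proof (intro sum.neutral ballI)
      fix i assume "i \<in> {..degree (pCons 0 q)}"
      then have "i \<le> n" using assms degree_pCons_le[of 0 q] by auto
      then show "cnj (coeff (pCons 0 q) i) *
          ip (poly (conj_reversal (\<Phi> n))) (\<lambda>z. z ^ i) = 0"
        using ip_conj_reversal[OF monic_orthogonal_\<Phi>, of i n] by (cases i) auto
    qed
  qed (intro continuous_intros)
  then show ?thesis by (simp add: \<phi>s_def[abs_def] ip_def)
qed

lemma ip_\<phi>_self: "ip (\<phi> n) (\<phi> n) = 1"
proof -
  have "ip (\<phi> n) (\<phi> n) = ip (poly (\<Phi> n)) (poly (\<Phi> n)) / (poly_norm n)\<^sup>2"
    by (simp add: \<phi>_def[abs_def] ip_def power2_eq_square)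
  also have "ip (poly (\<Phi> n)) (poly (\<Phi> n)) = (poly_norm n)\<^sup>2"
    unfolding ip_self poly_norm_def by simp
  finally show ?thesis using poly_norm_pos[of n] by simp
qed

lemma ip_\<phi>s_self: "ip (\<phi>s n) (\<phi>s n) = 1"
proof -
  have "ip (\<phi>s n) (\<phi>s n) = ip (\<phi> n) (\<phi> n)"
  proof (rule ip_cong)
    fix z :: complex assume z: "cmod z = 1"
    have "\<phi>s n z * cnj (\<phi>s n z) = z ^ n * (cnj z ^ n * (\<phi> n z * cnj (\<phi> n z)))"
      by (simp add: \<phi>s_circle z)
    then show "\<phi>s n z * cnj (\<phi>s n z) = \<phi> n z * cnj (\<phi> n z)"
      by (simp only: power_mult_cnj_power[OF z])
  qed
  then show ?thesis by (simp only: ip_\<phi>_self)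
qed

lemma szego: "z * \<phi> n z = cnj (\<alpha> n) * \<phi>s n z + \<rho> n * \<phi> (Suc n) z"
  using poly_norm_pos[of n] poly_norm_pos[of "Suc n"]
  by (simp add: \<phi>_def \<phi>s_def \<rho>_def szego_recursion field_simps)

lemma szego_reversed:
  assumes z: "cmod z = 1"
  shows "\<phi>s n z = \<alpha> n * (z * \<phi> n z) + \<rho> n * \<phi>s (Suc n) z"
proof -
  have "z ^ Suc n * cnj (z * \<phi> n z) = (z * cnj z) * (z ^ n * cnj (\<phi> n z))" by simp
  then have "\<phi>s n z = z ^ Suc n * cnj (z * \<phi> n z)"
    by (simp only: cnj_mult_self_circle[OF z] \<phi>s_circle[OF z] mult_1)
  also have "\<dots> = \<alpha> n * (z * (z ^ n * cnj (\<phi>s n z))) + \<rho> n * (z ^ Suc n * cnj (\<phi> (Suc n) z))"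
    unfolding szego by (simp add: algebra_simps)
  finally show ?thesis
    unfolding \<phi>s_circle[OF z, symmetric] \<phi>_circle[OF z, symmetric] .
qed

lemma ip_\<phi>s_\<phi>_Suc: "ip (\<phi>s n) (\<phi> (Suc n)) = 0"
proof -
  have "ip (\<phi> (Suc n)) (poly (conj_reversal (\<Phi> n))) = 0"
    using degree_conj_reversal_le[of "\<Phi> n"] by (intro ip_\<phi>_lower) (simp add: degree_\<Phi>)
  then have "ip (\<phi> (Suc n)) (\<phi>s n) = 0" by (simp add: \<phi>s_def[abs_def] ip_def)
  then show ?thesis by (subst ip_commute) simp
qed

text \<open>The theorem of Pythagoras in lemma \<open>szego\<close>: the left-hand side has norm one and the two functions
  on the right are orthonormal.\<close>

lemma \<rho>_\<alpha>: "of_real (\<rho> n) * of_real (\<rho> n) + \<alpha> n * cnj (\<alpha> n) = (1 :: complex)"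
proof -
  have "ip (\<lambda>z. z * \<phi> n z) (\<lambda>z. z * \<phi> n z) = ip (\<phi> n) (\<phi> n)"
  proof (rule ip_cong)
    fix z :: complex assume z: "cmod z = 1"
    have "z * \<phi> n z * cnj (z * \<phi> n z) = (z * cnj z) * (\<phi> n z * cnj (\<phi> n z))" by simp
    then show "z * \<phi> n z * cnj (z * \<phi> n z) = \<phi> n z * cnj (\<phi> n z)"
      by (simp only: cnj_mult_self_circle[OF z] mult_1)
  qed
  \<comment> \<open>The two summands are written as a sum over \<open>{0, 1}\<close> to expand the inner product bilinearly.\<close>
  define e where "e i = (if i = 0 then \<phi>s n else \<phi> (Suc n))" for i :: nat
  define a where "a i = (if i = 0 then cnj (\<alpha> n) else of_real (\<rho> n))" for i :: nat
  have e: "continuous_on unit_circle (e i)" for i by (simp add: e_def continuous_\<phi>)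
  have sz: "z * \<phi> n z = (\<Sum>i\<in>{0,1}. a i * e i z)" for z by (simp add: szego a_def e_def)
  have cont: "continuous_on unit_circle (\<lambda>z. \<Sum>i\<in>{0,1}. a i * e i z)"
    by (intro continuous_intros e)
  have o: "ip (\<phi> (Suc n)) (\<phi>s n) = 0" using ip_\<phi>s_\<phi>_Suc[of n] by (subst ip_commute) simp
  have "1 = ip (\<lambda>z. \<Sum>i\<in>{0,1}. a i * e i z) (\<lambda>z. \<Sum>i\<in>{0,1}. a i * e i z)"
    using \<open>ip (\<lambda>z. z * \<phi> n z) (\<lambda>z. z * \<phi> n z) = _\<close> ip_\<phi>_self[of n] by (simp only: sz)
  also have "\<dots> = (\<Sum>i\<in>{0,1}. a i * (\<Sum>j\<in>{0,1}. cnj (a j) * ip (e i) (e j)))"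
    by (subst ip_sum_left[OF e cont], subst ip_sum_right[OF e e]) simp
  also have "\<dots> = \<rho> n * \<rho> n + \<alpha> n * cnj (\<alpha> n)"
    by (simp add: a_def e_def ip_\<phi>_self ip_\<phi>s_self ip_\<phi>s_\<phi>_Suc o)
  finally show ?thesis by simp
qed

text \<open>The 2 by 2 matrix that expresses \<open>z \<phi>\<^sub>n\<close> and \<open>\<phi>s\<^sub>n\<^sub>+\<^sub>1\<close> through \<open>\<phi>s\<^sub>n\<close> and \<open>\<phi>\<^sub>n\<^sub>+\<^sub>1\<close> is unitary by
  lemma \<open>\<rho>_\<alpha>\<close>. The two equations are its second row and the second row of its inverse; the first
  rows are lemmas \<open>szego\<close> and \<open>szego_reversed\<close>.\<close>

lemma szego_inverse:
  assumes z: "cmod z = 1"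
  shows "\<phi>s (Suc n) z = \<rho> n * \<phi>s n z - \<alpha> n * \<phi> (Suc n) z"
    and "\<phi> (Suc n) z = \<rho> n * (z * \<phi> n z) - cnj (\<alpha> n) * \<phi>s (Suc n) z"
proof -
  have \<rho>0: "(of_real (\<rho> n) :: complex) \<noteq> 0" using \<rho>_pos[of n] by simp
  have one: "(1 :: complex) = \<rho> n * \<rho> n + \<alpha> n * cnj (\<alpha> n)" using \<rho>_\<alpha>[of n] by simp
  have "\<rho> n * \<phi>s (Suc n) z = (\<rho> n * \<rho> n + \<alpha> n * cnj (\<alpha> n)) * \<phi>s n z - \<alpha> n * (z * \<phi> n z)"
    unfolding one[symmetric] using szego_reversed[OF z, of n] by simp
  also have "\<dots> = \<rho> n * (\<rho> n * \<phi>s n z - \<alpha> n * \<phi> (Suc n) z)"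
    unfolding szego by (simp add: algebra_simps)
  finally show "\<phi>s (Suc n) z = \<rho> n * \<phi>s n z - \<alpha> n * \<phi> (Suc n) z" using \<rho>0 by simp
  have "\<rho> n * \<phi> (Suc n) z = (\<rho> n * \<rho> n + \<alpha> n * cnj (\<alpha> n)) * (z * \<phi> n z) - cnj (\<alpha> n) * \<phi>s n z"
    unfolding one[symmetric] using szego[of z n] by simp
  also have "\<dots> = \<rho> n * (\<rho> n * (z * \<phi> n z) - cnj (\<alpha> n) * \<phi>s (Suc n) z)"
    unfolding szego_reversed[OF z, of n] by (simp add: algebra_simps)
  finally show "\<phi> (Suc n) z = \<rho> n * (z * \<phi> n z) - cnj (\<alpha> n) * \<phi>s (Suc n) z" using \<rho>0 by simp
qed

section \<open>The CMV basis\<close>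

text \<open>The orthonormal basis of Laurent polynomials of Cantero, Moral and Velazquez, in its alternate form;
  on the circle the conjugates of these functions are the standard form. The exponents
  of \<open>z\<close> that occur there in \<open>cmv n\<close> range from \<open>- ((n + 1) div 2)\<close> to \<open>n div 2\<close>.\<close>

definition cmv :: "nat \<Rightarrow> complex \<Rightarrow> complex" where
  "cmv n z = cnj z ^ (Suc n div 2) * (if even n then \<phi> n z else \<phi>s n z)"

lemma continuous_cmv [continuous_intros]: "continuous_on A (cmv n)"
  unfolding cmv_def[abs_def] by (cases "even n") (auto intro!: continuous_intros)

lemma ip_cmv_self: "ip (cmv n) (cmv n) = 1"
proof -
  let ?f = "if even n then \<phi> n else \<phi>s n"
  have "ip (cmv n) (cmv n) = ip ?f ?f"
  proof (rule ip_cong)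
    fix z :: complex assume z: "cmod z = 1"
    have "cmv n z * cnj (cmv n z) =
        z ^ (Suc n div 2) * (cnj z ^ (Suc n div 2) * (?f z * cnj (?f z)))"
      by (simp add: cmv_def)
    then show "cmv n z * cnj (cmv n z) = ?f z * cnj (?f z)"
      by (simp only: power_mult_cnj_power[OF z])
  qed
  then show ?thesis by (simp add: ip_\<phi>_self ip_\<phi>s_self)
qed

lemma cmv_poly:
  obtains q where "degree q \<le> n" "\<And>z. cmv n z = cnj z ^ (Suc n div 2) * poly q z"
proof
  let ?q = "smult (1 / poly_norm n) (if even n then \<Phi> n else conj_reversal (\<Phi> n))"
  show "degree ?q \<le> n"
    using degree_conj_reversal_le[of "\<Phi> n"] degree_smult_le[of "1 / of_real (poly_norm n)"]
    by (auto simp: degree_\<Phi>)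
  show "cmv n z = cnj z ^ (Suc n div 2) * poly ?q z" for z
    by (simp add: cmv_def \<phi>_def \<phi>s_def)
qed

text \<open>After the negative power of \<open>z\<close> is moved to the other side, \<open>cmv i\<close> becomes a polynomial whose
  exponents lie in the range to which \<open>\<phi> j\<close> (namely \<open>0, \<dots>, j - 1\<close>) or \<open>\<phi>s j\<close> (namely \<open>1, \<dots>, j\<close>)
  is orthogonal.\<close>

lemma ip_cmv_less:
  assumes "i < j"
  shows "ip (cmv j) (cmv i) = 0"
proof -
  obtain q where q: "degree q \<le> i" "\<And>z. cmv i z = cnj z ^ (Suc i div 2) * poly q z"
    using cmv_poly by blast
  define k where "k = j div 2 - Suc i div 2"
  define q' where "q' = monom 1 k * q"
  have q': "poly q' z = z ^ k * poly q z" for z by (simp add: q'_def poly_monom)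
  have "degree q' \<le> k + i"
    using q(1) degree_mult_le[of "monom 1 k" q] by (simp add: q'_def degree_monom_eq)
  moreover have le: "Suc i div 2 \<le> j div 2" using assms by (intro div_le_mono) simp
  have "2 * (j div 2) \<le> j" "i \<le> 2 * (Suc i div 2)" by simp_all
  then have "k + i < j" using assms le unfolding k_def by linarith
  ultimately have deg: "degree q' < j" by simp
  have pw: "cnj z ^ (j div 2) * (z ^ (Suc i div 2) * w) = cnj z ^ k * w" if "cmod z = 1" for z w
  proof -
    have "cnj z ^ (j div 2) = cnj z ^ k * cnj z ^ (Suc i div 2)"
      using le by (simp add: k_def power_add[symmetric])
    then show ?thesis
      using power_mult_cnj_power[of "cnj z" "Suc i div 2" w] that by (simp add: mult.assoc)
  qed
  show ?thesis
  proof (cases "even j")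
    case True
    then have "Suc j div 2 = j div 2" by presburger
    then have cj: "cmv j z = cnj z ^ (j div 2) * \<phi> j z" for z
      using True by (simp add: cmv_def)
    have "ip (cmv j) (cmv i) = ip (\<phi> j) (poly q')"
    proof (rule ip_cong)
      fix z :: complex assume z: "cmod z = 1"
      have "cmv j z * cnj (cmv i z)
          = cnj z ^ (j div 2) * (z ^ (Suc i div 2) * (\<phi> j z * cnj (poly q z)))"
        by (simp add: cj q(2))
      then show "cmv j z * cnj (cmv i z) = \<phi> j z * cnj (poly q' z)"
        by (simp only: pw[OF z]) (simp add: q')
    qed
    then show ?thesis using ip_\<phi>_lower[OF deg] by simp
  next
    case False
    then have "Suc j div 2 = Suc (j div 2)" by presburger
    then have cj: "cmv j z = cnj z * cnj z ^ (j div 2) * \<phi>s j z" for z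
      using False by (simp add: cmv_def)
    have "ip (cmv j) (cmv i) = ip (\<phi>s j) (\<lambda>z. z * poly q' z)"
    proof (rule ip_cong)
      fix z :: complex assume z: "cmod z = 1"
      have "cmv j z * cnj (cmv i z)
          = cnj z ^ (j div 2) * (z ^ (Suc i div 2) * (cnj z * \<phi>s j z * cnj (poly q z)))"
        by (simp add: cj q(2))
      then show "cmv j z * cnj (cmv i z) = \<phi>s j z * cnj (z * poly q' z)"
        by (simp only: pw[OF z]) (simp add: q')
    qed
    then show ?thesis using ip_\<phi>s_lower[OF deg] by simp
  qed
qed

lemma cmv_orthonormal: "ip (cmv i) (cmv j) = (if i = j then 1 else 0)"
proof (cases i j rule: linorder_cases)
  case less
  then show ?thesis by (subst ip_commute) (simp add: ip_cmv_less)
qed (auto simp: ip_cmv_self ip_cmv_less)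

definition offdiag :: "nat \<Rightarrow> real" where
  "offdiag n = (case n of 0 \<Rightarrow> 0 | Suc m \<Rightarrow> \<rho> m)"

text \<open>The value \<open>-1\<close> is the usual convention for \<open>\<alpha>\<^sub>-\<^sub>1\<close>; together with \<open>offdiag 0 = 0\<close> it makes the
  relations below hold also for \<open>n = 0\<close>.\<close>

definition shifted_\<alpha> :: "nat \<Rightarrow> complex" where
  "shifted_\<alpha> n = (case n of 0 \<Rightarrow> -1 | Suc m \<Rightarrow> \<alpha> m)"

lemma cmv_0: "cmv 0 z = 1"
  by (simp add: cmv_def \<phi>_0)

text \<open>These two relations and the two for odd indices are the four forms of the recursion of Szego,
  multiplied by a power of \<open>cnj z\<close>.\<close>

lemma cmv_conj_even:
  assumes z: "cmod z = 1" and n: "even n"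
  shows "cnj z * cnj (cmv n z) = shifted_\<alpha> (Suc n) * cmv n z + offdiag (Suc n) * cmv (Suc n) z"
    and "cnj (cmv n z) = offdiag n * cmv (n - 1) z - shifted_\<alpha> n * cmv n z"
proof -
  obtain k where k: "n = 2 * k" using n by blast
  have cz: "cmod (cnj z) = 1" using z by simp
  have conj: "cnj (cmv n z) = cnj z ^ k * \<phi>s n z"
    using z power_mult_cnj_power[OF cz, of k]
    by (simp add: k cmv_def \<phi>s_circle mult_2 power_add mult.assoc)
  have "cnj z * cnj (cmv n z) = cnj z ^ Suc k * (\<alpha> n * (z * \<phi> n z) + \<rho> n * \<phi>s (Suc n) z)"
    unfolding conj by (subst szego_reversed[OF z, of n]) simp
  also have "\<dots> = \<alpha> n * (cnj z ^ k * ((cnj z * z) * \<phi> n z)) + \<rho> n * (cnj z ^ Suc k * \<phi>s (Suc n) z)"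
    by (simp add: algebra_simps)
  finally show "cnj z * cnj (cmv n z) =
      shifted_\<alpha> (Suc n) * cmv n z + offdiag (Suc n) * cmv (Suc n) z"
    using k by (simp add: shifted_\<alpha>_def offdiag_def cmv_def cnj_mult_self_circle[OF z])
  show "cnj (cmv n z) = offdiag n * cmv (n - 1) z - shifted_\<alpha> n * cmv n z"
  proof (cases n)
    case 0
    then show ?thesis by (simp add: cmv_0 offdiag_def shifted_\<alpha>_def)
  next
    case (Suc m)
    then have m: "odd m" "Suc m div 2 = k" "Suc (Suc m) div 2 = k" using k by presburger+
    have "cnj (cmv n z) = cnj z ^ k * (\<rho> m * \<phi>s m z - \<alpha> m * \<phi> (Suc m) z)"
      unfolding conj using szego_inverse(1)[OF z, of m] by (simp add: Suc)
    also have "\<dots> = offdiag n * cmv (n - 1) z - shifted_\<alpha> n * cmv n z"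
      using m by (simp add: Suc cmv_def offdiag_def shifted_\<alpha>_def algebra_simps)
    finally show ?thesis .
  qed
qed

lemma cmv_conj_odd:
  assumes z: "cmod z = 1" and n: "odd n"
  shows "cnj (cmv n z) = cnj (shifted_\<alpha> (Suc n)) * cmv n z + offdiag (Suc n) * cmv (Suc n) z"
    and "cnj z * cnj (cmv n z) = offdiag n * cmv (n - 1) z - cnj (shifted_\<alpha> n) * cmv n z"
proof -
  obtain m where m: "n = Suc m" "even m" using n by (cases n) auto
  then obtain k where k: "m = 2 * k" by blast
  have div: "Suc m div 2 = k" "Suc (Suc m) div 2 = Suc k" "Suc (Suc (Suc m)) div 2 = Suc k"
    using k by presburger+
  have cz: "cmod (cnj z) = 1" using z by simp
  have conj: "cnj z * cnj (cmv n z) = cnj z ^ Suc k * \<phi> n z"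
  proof -
    have "cnj z ^ Suc k * \<phi> n z = cnj z ^ Suc k * (z ^ (Suc k + k) * cnj (\<phi>s n z))"
    proof -
      have nk: "n = Suc k + k" using m k by simp
      show ?thesis by (subst nk[symmetric], subst \<phi>_circle[OF z, of n]) (rule refl)
    qed
    also have "\<dots> = z ^ k * cnj (\<phi>s n z)"
      unfolding power_add using power_mult_cnj_power[OF cz, of "Suc k"] by (simp add: mult.assoc)
    also have "\<dots> = cnj z * (z ^ Suc k * cnj (\<phi>s n z))"
      using power_mult_cnj_power[OF cz, of 1] by (simp add: mult.assoc)
    finally have "cnj z ^ Suc k * \<phi> n z = cnj z * (z ^ Suc k * cnj (\<phi>s n z))" .
    moreover have "cnj (cmv n z) = z ^ Suc k * cnj (\<phi>s n z)" using m div by (simp add: cmv_def)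
    ultimately show ?thesis by (simp only:)
  qed
  have "cnj (cmv n z) = (z * cnj z) * cnj (cmv n z)" using cnj_mult_self_circle[OF z] by simp
  also have "\<dots> = cnj z ^ Suc k * (z * \<phi> n z)" using conj by (simp add: mult.assoc)
  also have "\<dots> = cnj z ^ Suc k * (cnj (\<alpha> n) * \<phi>s n z + \<rho> n * \<phi> (Suc n) z)" unfolding szego ..
  finally show "cnj (cmv n z) =
      cnj (shifted_\<alpha> (Suc n)) * cmv n z + offdiag (Suc n) * cmv (Suc n) z"
    using m div by (simp add: cmv_def shifted_\<alpha>_def offdiag_def algebra_simps)
  have "cnj z * cnj (cmv n z)
      = cnj z ^ Suc k * (\<rho> m * (z * \<phi> m z) - cnj (\<alpha> m) * \<phi>s (Suc m) z)"
    unfolding conj using szego_inverse(2)[OF z, of m] by (simp add: m(1))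
  also have "\<dots> = \<rho> m * (cnj z ^ k * ((cnj z * z) * \<phi> m z))
      - cnj (\<alpha> m) * (cnj z ^ Suc k * \<phi>s (Suc m) z)" by (simp add: algebra_simps)
  finally show "cnj z * cnj (cmv n z) = offdiag n * cmv (n - 1) z - cnj (shifted_\<alpha> n) * cmv n z"
    using m div by (simp add: cmv_def shifted_\<alpha>_def offdiag_def cnj_mult_self_circle[OF z])
qed

end

section \<open>Symmetric tridiagonal matrices shifted by an imaginary constant\<close>

text \<open>For \<open>J\<close> the real symmetric tridiagonal matrix with entries \<open>r\<close> and \<open>b\<close>, the left-hand side is
  \<open>\<kappa>\<^sup>2 * \<parallel>h\<parallel>\<^sup>2\<close> and the right-hand side is \<open>\<parallel>(J + \<i> * \<kappa>) h\<parallel>\<^sup>2\<close>. The cross term is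
  \<open>2 * \<kappa> * Im \<langle>J h, h\<rangle> = 0\<close>; along the index it telescopes.\<close>

lemma shifted_tridiagonal_bound:
  fixes h :: "nat \<Rightarrow> complex" and r b :: "nat \<Rightarrow> real" and \<kappa> :: real
  assumes r0: "r 0 = 0" and h0: "\<And>j. j \<ge> n \<Longrightarrow> h j = 0"
  shows "\<kappa>\<^sup>2 * (\<Sum>i\<le>n. (cmod (h i))\<^sup>2) \<le>
    (\<Sum>i\<le>n. (cmod (r i * h (i - 1) + Complex (b i) \<kappa> * h i + r (Suc i) * h (Suc i)))\<^sup>2)"
proof -
  define u where "u i = r i * h (i - 1) + b i * h i + r (Suc i) * h (Suc i)" for i
  define t where "t i = r i * Im (h i * cnj (h (i - 1)))" for i
  have split: "(cmod (r i * h (i - 1) + Complex (b i) \<kappa> * h i + r (Suc i) * h (Suc i)))\<^sup>2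
      = (cmod (u i))\<^sup>2 + \<kappa>\<^sup>2 * (cmod (h i))\<^sup>2 + 2 * \<kappa> * (t (Suc i) - t i)" for i
  proof -
    have "r i * h (i - 1) + Complex (b i) \<kappa> * h i + r (Suc i) * h (Suc i) = u i + \<i> * \<kappa> * h i"
      by (simp add: u_def complex_eq_iff algebra_simps)
    moreover have "(cmod (u i + \<i> * \<kappa> * h i))\<^sup>2
        = (cmod (u i))\<^sup>2 + \<kappa>\<^sup>2 * (cmod (h i))\<^sup>2 + 2 * \<kappa> * Im (u i * cnj (h i))"
      unfolding cmod_power2 by (simp add: power2_eq_square algebra_simps)
    moreover have "Im (u i * cnj (h i)) = t (Suc i) - t i"
      by (simp add: u_def t_def algebra_simps)
    ultimately show ?thesis by simp
  qed
  have "(\<Sum>i\<le>n. t (Suc i) - t i) = t (Suc n) - t 0"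
    using sum_lessThan_telescope[of t "Suc n"] by (simp add: lessThan_Suc_atMost)
  also have "\<dots> = 0" using h0 r0 by (simp add: t_def)
  finally have tele: "(\<Sum>i\<le>n. t (Suc i) - t i) = 0" .
  have "(\<Sum>i\<le>n. (cmod (r i * h (i - 1) + Complex (b i) \<kappa> * h i + r (Suc i) * h (Suc i)))\<^sup>2)
      = (\<Sum>i\<le>n. (cmod (u i))\<^sup>2) + \<kappa>\<^sup>2 * (\<Sum>i\<le>n. (cmod (h i))\<^sup>2)"
    unfolding split sum.distrib sum_distrib_left[symmetric] tele by simp
  moreover have "(\<Sum>i\<le>n. (cmod (u i))\<^sup>2) \<ge> 0" by (intro sum_nonneg) simp
  ultimately show ?thesis by linarith
qed

text \<open>The rows of the matrix are exchanged with its columns, which is the same since it is symmetric. The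
  last summands cause no loss because \<open>h n = 0\<close>.\<close>

lemma tridiagonal_sum_transpose:
  fixes h y :: "nat \<Rightarrow> complex" and r B :: "nat \<Rightarrow> complex"
  assumes r0: "r 0 = 0" and h0: "\<And>j. j \<ge> n \<Longrightarrow> h j = 0"
  shows "(\<Sum>j\<le>n. h j * (r j * y (j - 1) + B j * y j + r (Suc j) * y (Suc j)))
       = (\<Sum>i\<le>n. (r i * h (i - 1) + B i * h i + r (Suc i) * h (Suc i)) * y i)"
proof -
  have down: "(\<Sum>j\<le>n. h j * (r j * y (j - 1))) = (\<Sum>i\<le>n. r (Suc i) * h (Suc i) * y i)"
  proof -
    have "(\<Sum>j\<le>n. h j * (r j * y (j - 1))) = (\<Sum>j\<le>Suc n. h j * (r j * y (j - 1)))"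
      using h0 by simp
    also have "\<dots> = (\<Sum>i\<le>n. r (Suc i) * h (Suc i) * y i)"
      unfolding sum.atMost_Suc_shift using r0 by (simp add: ac_simps)
    finally show ?thesis .
  qed
  have up: "(\<Sum>j\<le>n. h j * (r (Suc j) * y (Suc j))) = (\<Sum>i\<le>n. r i * h (i - 1) * y i)"
  proof -
    have "(\<Sum>i\<le>n. r i * h (i - 1) * y i) = (\<Sum>i\<le>Suc n. r i * h (i - 1) * y i) -
        r (Suc n) * h n * y (Suc n)" by simp
    also have "\<dots> = (\<Sum>j\<le>n. h j * (r (Suc j) * y (Suc j)))"
      unfolding sum.atMost_Suc_shift using r0 h0 by (simp add: ac_simps)
    finally show ?thesis by simp
  qed
  show ?thesis
    unfolding distrib_left distrib_right sum.distrib down up by (simp add: ac_simps)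
qed

section \<open>The span of a family of functions on the circle\<close>

text \<open>Membership depends only on the values on the circle. The coefficient \<open>h n\<close> of the last summand is
  zero, so that a tridiagonal matrix does not lead out of the range \<open>{..n}\<close>.\<close>

definition circle_span :: "(nat \<Rightarrow> complex \<Rightarrow> complex) \<Rightarrow> (complex \<Rightarrow> complex) set" where
  "circle_span y = {f. \<exists>h n. (\<forall>j\<ge>n. h j = 0) \<and>
     (\<forall>z. cmod z = 1 \<longrightarrow> f z = (\<Sum>j\<le>n. h j * y j z))}"

lemma circle_spanI:
  assumes "\<And>j. j \<ge> n \<Longrightarrow> h j = 0" "\<And>z. cmod z = 1 \<Longrightarrow> f z = (\<Sum>j\<le>n. h j * y j z)"
  shows "f \<in> circle_span y"
  using assms unfolding circle_span_def by blast

lemma circle_spanE: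
  assumes "f \<in> circle_span y"
  obtains n h where "\<And>j. j \<ge> n \<Longrightarrow> h j = 0"
    "\<And>m z. m \<ge> n \<Longrightarrow> cmod z = 1 \<Longrightarrow> f z = (\<Sum>j\<le>m. h j * y j z)"
proof -
  obtain n h where h: "\<And>j. j \<ge> n \<Longrightarrow> h j = 0"
    "\<And>z. cmod z = 1 \<Longrightarrow> f z = (\<Sum>j\<le>n. h j * y j z)"
    using assms unfolding circle_span_def by blast
  have "f z = (\<Sum>j\<le>m. h j * y j z)" if "m \<ge> n" "cmod z = 1" for m z
    unfolding h(2)[OF that(2)] using that h(1) by (intro sum.mono_neutral_left) auto
  then show ?thesis using h that by blast
qed

lemma circle_span_cong:
  assumes "f \<in> circle_span y" "\<And>z. cmod z = 1 \<Longrightarrow> g z = f z"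
  shows "g \<in> circle_span y"
  using assms unfolding circle_span_def by simp

lemma circle_span_base: "y j \<in> circle_span y"
proof (rule circle_spanI)
  show "y j z = (\<Sum>i\<le>Suc j. (if i = j then 1 else 0) * y i z)" for z
    by (subst sum.mono_neutral_right[of _ "{j}"]) auto
qed auto

lemma circle_span_lincomb:
  assumes "f \<in> circle_span y" "g \<in> circle_span y"
  shows "(\<lambda>z. a * f z + b * g z) \<in> circle_span y"
proof -
  obtain n h where h: "\<And>j. j \<ge> n \<Longrightarrow> h j = 0"
    "\<And>m z. m \<ge> n \<Longrightarrow> cmod z = 1 \<Longrightarrow> f z = (\<Sum>j\<le>m. h j * y j z)"
    using assms(1) that by (rule circle_spanE)
  obtain n' h' where h': "\<And>j. j \<ge> n' \<Longrightarrow> h' j = 0"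
    "\<And>m z. m \<ge> n' \<Longrightarrow> cmod z = 1 \<Longrightarrow> g z = (\<Sum>j\<le>m. h' j * y j z)"
    using assms(2) that by (rule circle_spanE)
  show ?thesis
  proof (rule circle_spanI[of "max n n'" "\<lambda>j. a * h j + b * h' j"])
    fix z :: complex assume z: "cmod z = 1"
    show "a * f z + b * g z = (\<Sum>j\<le>max n n'. (a * h j + b * h' j) * y j z)"
      unfolding h(2)[OF max.cobounded1[of n n'] z] h'(2)[OF max.cobounded2[of n' n] z]
      by (simp add: sum_distrib_left sum.distrib algebra_simps)
  qed (use h h' in auto)
qed

lemma circle_span_sum:
  assumes "finite A" "\<And>i. i \<in> A \<Longrightarrow> f i \<in> circle_span y"
  shows "(\<lambda>z. \<Sum>i\<in>A. c i * f i z) \<in> circle_span y"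
  using assms
proof (induction A rule: finite_induct)
  case empty
  show ?case by (rule circle_spanI[of 0 "\<lambda>_. 0"]) auto
next
  case (insert i A)
  then show ?case using circle_span_lincomb[of "f i" y "\<lambda>z. \<Sum>i\<in>A. c i * f i z" "c i" 1] by simp
qed

lemma circle_span_trans:
  assumes "f \<in> circle_span x" "\<And>j. x j \<in> circle_span y"
  shows "f \<in> circle_span y"
proof -
  obtain n h where h: "\<And>j. j \<ge> n \<Longrightarrow> h j = 0"
    "\<And>m z. m \<ge> n \<Longrightarrow> cmod z = 1 \<Longrightarrow> f z = (\<Sum>j\<le>m. h j * x j z)"
    using assms(1) that by (rule circle_spanE)
  have "(\<lambda>z. \<Sum>j\<le>n. h j * x j z) \<in> circle_span y"
    by (intro circle_span_sum assms(2) finite_atMost)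
  then show ?thesis by (rule circle_span_cong) (rule h(2)[OF order_refl])
qed

text \<open>The span is closed under the two antilinear maps \<open>f \<mapsto> cnj f\<close> and \<open>f \<mapsto> cnj z * cnj f\<close>, hence under
  multiplication by \<open>z\<close>, which is the second map followed by the first.\<close>

lemma circle_span_contains_poly:
  assumes one: "(\<lambda>z. 1) \<in> circle_span y"
    and conj: "\<And>j. (\<lambda>z. cnj (y j z)) \<in> circle_span y"
    and conj': "\<And>j. (\<lambda>z. cnj z * cnj (y j z)) \<in> circle_span y"
  shows "poly p \<in> circle_span y"
proof -
  have "(\<lambda>z. cnj (f z)) \<in> circle_span y \<and> (\<lambda>z. cnj z * cnj (f z)) \<in> circle_span y"
    if f: "f \<in> circle_span y" for f
  proof -
    obtain n h where h: "\<And>j. j \<ge> n \<Longrightarrow> h j = 0"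
      "\<And>m z. m \<ge> n \<Longrightarrow> cmod z = 1 \<Longrightarrow> f z = (\<Sum>j\<le>m. h j * y j z)"
      using f that by (rule circle_spanE)
    have "(\<lambda>z. \<Sum>j\<le>n. cnj (h j) * cnj (y j z)) \<in> circle_span y"
      "(\<lambda>z. \<Sum>j\<le>n. cnj (h j) * (cnj z * cnj (y j z))) \<in> circle_span y"
      by (intro circle_span_sum conj conj' finite_atMost)+
    then show ?thesis
      by (intro conjI; elim circle_span_cong)
         (simp_all add: h(2)[OF order_refl] sum_distrib_left ac_simps)
  qed
  then have mult: "(\<lambda>z. z * f z) \<in> circle_span y" if "f \<in> circle_span y" for f
  proof -
    have "(\<lambda>z. cnj (cnj z * cnj (f z))) \<in> circle_span y"
      using that \<open>\<And>f. f \<in> circle_span y \<Longrightarrow> _\<close> by blast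
    then show ?thesis by simp
  qed
  have "(\<lambda>z. z ^ i) \<in> circle_span y" for i
    using one mult by (induction i) auto
  then have "(\<lambda>z. \<Sum>i\<le>degree p. coeff p i * z ^ i) \<in> circle_span y"
    by (intro circle_span_sum) auto
  then show ?thesis by (simp add: poly_altdef[abs_def])
qed

context circle_measure
begin

lemma parseval:
  assumes cont: "\<And>j. continuous_on unit_circle (y j)"
    and orth: "\<And>i j. ip (y i) (y j) = (if i = j then 1 else 0)"
    and fin: "finite A"
  shows "(LINT z|\<mu>. (cmod (\<Sum>j\<in>A. h j * y j z))\<^sup>2) = (\<Sum>j\<in>A. (cmod (h j))\<^sup>2)"
proof -
  let ?f = "\<lambda>z. \<Sum>j\<in>A. h j * y j z"
  have contf: "continuous_on unit_circle ?f" by (intro continuous_intros cont)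
  have "ip ?f ?f = (\<Sum>i\<in>A. h i * (\<Sum>j\<in>A. cnj (h j) * ip (y i) (y j)))"
    by (subst ip_sum_left[OF cont contf], subst ip_sum_right[OF cont cont]) simp
  also have "\<dots> = (\<Sum>i\<in>A. h i * cnj (h i))"
    using fin by (simp add: orth sum.delta' if_distrib cong: if_cong)
  also have "\<dots> = of_real (\<Sum>j\<in>A. (cmod (h j))\<^sup>2)"
    by (simp add: complex_norm_square[symmetric])
  finally show ?thesis unfolding ip_self of_real_eq_iff .
qed

text \<open>In the basis \<open>y\<close> the antilinear map \<open>f \<mapsto> (1 + cnj z) * cnj f\<close>, which has the same pointwise
  modulus as multiplication by \<open>1 + z\<close>, conjugates the coefficients and applies the matrix of
  lemma \<open>shifted_tridiagonal_bound\<close>.\<close>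

lemma tridiagonal_lower_bound:
  fixes y :: "nat \<Rightarrow> complex \<Rightarrow> complex" and r b :: "nat \<Rightarrow> real" and \<kappa> :: real
  assumes cont: "\<And>j. continuous_on unit_circle (y j)"
    and orth: "\<And>i j. ip (y i) (y j) = (if i = j then 1 else 0)"
    and r0: "r 0 = 0"
    and rec: "\<And>j z. cmod z = 1 \<Longrightarrow> (1 + cnj z) * cnj (y j z) =
      r j * y (j - 1) z + Complex (b j) \<kappa> * y j z + r (Suc j) * y (Suc j) z"
    and f: "f \<in> circle_span y"
  shows "\<kappa>\<^sup>2 * (LINT z|\<mu>. (cmod (f z))\<^sup>2) \<le> (LINT z|\<mu>. (cmod (1 + z))\<^sup>2 * (cmod (f z))\<^sup>2)"
proof -
  obtain n h where h: "\<And>j. j \<ge> n \<Longrightarrow> h j = 0"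
    and fh: "\<And>m z. m \<ge> n \<Longrightarrow> cmod z = 1 \<Longrightarrow> f z = (\<Sum>j\<le>m. h j * y j z)"
    using f that by (rule circle_spanE)
  define g where "g j = cnj (h j)" for j
  have g0: "g j = 0" if "j \<ge> n" for j using h that by (simp add: g_def)
  define u where "u i = r i * g (i - 1) + Complex (b i) \<kappa> * g i + r (Suc i) * g (Suc i)" for i
  have "(LINT z|\<mu>. (cmod (f z))\<^sup>2) = (LINT z|\<mu>. (cmod (\<Sum>j\<le>n. h j * y j z))\<^sup>2)"
    by (intro integral_circle_cong) (simp only: fh[OF order_refl])
  also have "\<dots> = (\<Sum>j\<le>n. (cmod (h j))\<^sup>2)" by (intro parseval cont orth finite_atMost)
  also have "\<dots> = (\<Sum>j\<le>n. (cmod (g j))\<^sup>2)" by (simp add: g_def)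
  finally have lhs: "(LINT z|\<mu>. (cmod (f z))\<^sup>2) = (\<Sum>j\<le>n. (cmod (g j))\<^sup>2)" .
  have "(LINT z|\<mu>. (cmod (1 + z))\<^sup>2 * (cmod (f z))\<^sup>2) = (LINT z|\<mu>. (cmod (\<Sum>i\<le>n. u i * y i z))\<^sup>2)"
  proof (rule integral_circle_cong)
    fix z :: complex assume z: "cmod z = 1"
    have "(1 + cnj z) * cnj (f z) = (\<Sum>j\<le>n. g j * ((1 + cnj z) * cnj (y j z)))"
      using fh[of n z] z by (simp add: sum_distrib_left g_def ac_simps)
    also have "\<dots> = (\<Sum>j\<le>n. g j * (r j * y (j - 1) z + Complex (b j) \<kappa> * y j z + r (Suc j) * y (Suc j) z))"
      by (simp only: rec[OF z])
    also have "\<dots> = (\<Sum>i\<le>n. u i * y i z)"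
      unfolding u_def using r0 g0 by (intro tridiagonal_sum_transpose) auto
    finally have "cmod (\<Sum>i\<le>n. u i * y i z) = cmod (cnj ((1 + z) * f z))" by simp
    also have "\<dots> = cmod (1 + z) * cmod (f z)" unfolding complex_mod_cnj norm_mult ..
    finally show "(cmod (1 + z))\<^sup>2 * (cmod (f z))\<^sup>2 = (cmod (\<Sum>i\<le>n. u i * y i z))\<^sup>2"
      by (simp add: power_mult_distrib)
  qed
  also have "\<dots> = (\<Sum>i\<le>n. (cmod (u i))\<^sup>2)" by (intro parseval cont orth finite_atMost)
  finally show ?thesis
    unfolding lhs u_def
    using shifted_tridiagonal_bound[where r = r and h = g and n = n and b = b and \<kappa> = \<kappa>] r0 g0
    by simp
qed

section \<open>A spectral gap from alternating Verblunsky coefficients\<close>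

text \<open>The condition on \<open>\<epsilon>\<^sup>2\<close> is the alternation condition for the index \<open>-1\<close>, where \<open>\<alpha>\<^sub>-\<^sub>1 = -1\<close>. Consecutive
  imaginary parts have opposite signs, so that every difference \<open>\<epsilon>\<^sup>2 * (\<alpha>\<^sub>n - \<alpha>\<^sub>n\<^sub>-\<^sub>1)\<close> has the imaginary
  part \<open>(-1)\<^sup>n * \<kappa>\<close>; the conjugation at odd indices removes the sign.\<close>

theorem verblunsky_spectral_gap:
  fixes \<epsilon> :: complex and \<kappa> :: real
  assumes \<epsilon>: "cmod \<epsilon> = 1" and \<kappa>: "Im (\<epsilon>\<^sup>2) = \<kappa> / 2"
    and alt: "\<And>n. Im (\<epsilon>\<^sup>2 * \<alpha> n) = (-1) ^ n * \<kappa> / 2"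
  shows "\<kappa>\<^sup>2 * (LINT z|\<mu>. (cmod (poly p z))\<^sup>2)
    \<le> (LINT z|\<mu>. (cmod (1 + z))\<^sup>2 * (cmod (poly p z))\<^sup>2)"
proof -
  \<comment> \<open>Neighbours carry conjugate phases, which leaves the off-diagonal entries unchanged and multiplies
    the diagonal ones by \<open>\<epsilon>\<^sup>2\<close> or its conjugate.\<close>
  define e where "e n = (if even n then cnj \<epsilon> else \<epsilon>)" for n :: nat
  define y where "y n z = e n * cmv n z" for n z
  define w where "w n = \<epsilon>\<^sup>2 * (shifted_\<alpha> (Suc n) - shifted_\<alpha> n)" for n
  define \<beta> where "\<beta> n = (if even n then w n else cnj (w n))" for n
  have e1: "e n * cnj (e n) = 1" for n using cnj_mult_self_circle[OF \<epsilon>] by (simp add: e_def)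
  have e_swap: "cnj (e n) = e (Suc n)" for n by (simp add: e_def)
  have e_pred: "offdiag n * cnj (e n) = offdiag n * e (n - 1)" for n
    by (cases n) (auto simp: e_def offdiag_def)
  have cont: "continuous_on unit_circle (y j)" for j
    unfolding y_def[abs_def] by (intro continuous_intros)
  have orth: "ip (y i) (y j) = (if i = j then 1 else 0)" for i j
  proof -
    have "ip (y i) (y j) = e i * cnj (e j) * ip (cmv i) (cmv j)"
      unfolding ip_def y_def by (simp add: ac_simps flip: Bochner_Integration.integral_mult_right_zero)
    then show ?thesis by (simp add: cmv_orthonormal e1)
  qed
  have alt': "Im (\<epsilon>\<^sup>2 * shifted_\<alpha> n) = - ((-1) ^ n * \<kappa> / 2)" for n
  proof (cases n)
    case 0
    then show ?thesis using \<kappa> by (simp add: shifted_\<alpha>_def)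
  next
    case (Suc m)
    then have "Im (\<epsilon>\<^sup>2 * shifted_\<alpha> n) = Im (\<epsilon>\<^sup>2 * \<alpha> m)" by (simp add: shifted_\<alpha>_def)
    also have "\<dots> = (-1) ^ m * \<kappa> / 2" by (rule alt)
    finally show ?thesis by (simp add: Suc)
  qed
  have "Im (w n) = (-1) ^ n * \<kappa>" for n
    unfolding w_def right_diff_distrib minus_complex.sel alt' by simp
  then have Im_\<beta>: "Im (\<beta> n) = \<kappa>" for n by (simp add: \<beta>_def)
  have \<beta>: "\<beta> n = Complex (Re (\<beta> n)) \<kappa>" for n using Im_\<beta>[of n] by (simp add: complex_eq_iff)
  have e_sq: "cnj (e n) = (if even n then \<epsilon>\<^sup>2 else cnj (\<epsilon>\<^sup>2)) * e n" for n
    using cnj_mult_self_circle[OF \<epsilon>] by (simp add: e_def power2_eq_square mult.assoc)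
  have rec: "(1 + cnj z) * cnj (y n z) = offdiag n * y (n - 1) z + Complex (Re (\<beta> n)) \<kappa> * y n z
      + offdiag (Suc n) * y (Suc n) z" if z: "cmod z = 1" for n z
  proof -
    define \<gamma> where "\<gamma> = (let w = shifted_\<alpha> (Suc n) - shifted_\<alpha> n in if even n then w else cnj w)"
    have "(1 + cnj z) * cnj (cmv n z) = cnj (cmv n z) + cnj z * cnj (cmv n z)"
      by (simp add: distrib_right)
    also have "\<dots> = offdiag n * cmv (n - 1) z + \<gamma> * cmv n z + offdiag (Suc n) * cmv (Suc n) z"
    proof (cases "even n")
      case True
      show ?thesis
        by (rule trans[OF arg_cong2[where f = "(+)", OF cmv_conj_even(2,1)[OF z True]]])
           (simp add: True \<gamma>_def algebra_simps)
    next
      case False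
      show ?thesis
        by (rule trans[OF arg_cong2[where f = "(+)", OF cmv_conj_odd[OF z False]]])
           (simp add: False \<gamma>_def algebra_simps)
    qed
    finally have "(1 + cnj z) * cnj (cmv n z) =
        offdiag n * cmv (n - 1) z + \<gamma> * cmv n z + offdiag (Suc n) * cmv (Suc n) z" .
    then have "(1 + cnj z) * cnj (y n z) = (offdiag n * cnj (e n)) * cmv (n - 1) z
        + (cnj (e n) * \<gamma>) * cmv n z + offdiag (Suc n) * cnj (e n) * cmv (Suc n) z"
      by (simp add: y_def algebra_simps)
    moreover have "cnj (e n) * \<gamma> = \<beta> n * e n"
      by (subst e_sq) (simp add: \<beta>_def w_def \<gamma>_def Let_def)
    ultimately show ?thesis
      unfolding e_pred \<beta>[symmetric] using e_swap by (simp add: y_def mult.assoc)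
  qed
  have base: "cmv n \<in> circle_span y" for n
    using circle_span_lincomb[OF circle_span_base[of y n] circle_span_base[of y n], of "cnj (e n)" 0]
      e1[of n] by (auto elim!: circle_span_cong simp: y_def mult.commute mult.left_commute)
  have "poly p \<in> circle_span cmv"
  proof (rule circle_span_contains_poly)
    show "(\<lambda>z. 1) \<in> circle_span cmv"
      using circle_span_base[of cmv 0] by (simp add: cmv_0[abs_def])
    note comb = circle_span_lincomb[OF circle_span_base circle_span_base, of _ cmv]
    fix n
    show "(\<lambda>z. cnj (cmv n z)) \<in> circle_span cmv"
    proof (cases "even n")
      case True
      show ?thesis
        by (rule circle_span_cong[OF comb[of "offdiag n" "n - 1" "- shifted_\<alpha> n" n]])
           (simp add: cmv_conj_even(2)[OF _ True])
    next
      case False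
      show ?thesis
        by (rule circle_span_cong[OF comb[of "cnj (shifted_\<alpha> (Suc n))" n "offdiag (Suc n)" "Suc n"]])
           (rule cmv_conj_odd(1)[OF _ False])
    qed
    show "(\<lambda>z. cnj z * cnj (cmv n z)) \<in> circle_span cmv"
    proof (cases "even n")
      case True
      show ?thesis
        by (rule circle_span_cong[OF comb[of "shifted_\<alpha> (Suc n)" n "offdiag (Suc n)" "Suc n"]])
           (rule cmv_conj_even(1)[OF _ True])
    next
      case False
      show ?thesis
        by (rule circle_span_cong[OF comb[of "offdiag n" "n - 1" "- cnj (shifted_\<alpha> n)" n]])
           (simp add: cmv_conj_odd(2)[OF _ False])
    qed
  qed
  then have "poly p \<in> circle_span y" using base by (rule circle_span_trans)
  then show ?thesis
    using tridiagonal_lower_bound[of y offdiag "\<lambda>n. Re (\<beta> n)" \<kappa>, OF cont orth _ rec]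
    by (simp add: offdiag_def)
qed

section \<open>Localising the support\<close>

text \<open>If \<open>w\<close> were a point of the support with \<open>Re w < a\<close>, take the powers of the polynomial
  \<open>(1 + cnj w * z) / 2\<close>. On the circle its squared modulus is \<open>1 - \<bar>z - w\<bar>\<^sup>2 / 4\<close>. The integrand is
  negative at distance less than \<open>\<eta>\<close> from \<open>w\<close>; there the squared modulus is at least \<open>s\<close> on a smaller
  ball of positive measure, and further away it is at most \<open>t < s\<close>. So the negative part of the
  integral wins for large powers.\<close>

lemma support_subset_half_plane:
  assumes pos: "\<And>p. (LINT z|\<mu>. (Re z - a) * (cmod (poly p z))\<^sup>2) \<ge> 0"
  shows "measure_support \<mu> \<subseteq> {z \<in> unit_circle. a \<le> Re z}"
proof
  fix w assume w: "w \<in> measure_support \<mu>"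
  then have w1: "cmod w = 1" by (auto simp: measure_support_def space_circle)
  show "w \<in> {z \<in> unit_circle. a \<le> Re z}"
  proof (rule ccontr)
    assume "\<not> ?thesis"
    then have lt: "Re w < a" using w1 by auto
    \<comment> \<open>The bound \<open>\<eta> \<le> 1\<close> makes \<open>t\<close> positive.\<close>
    define \<eta> where "\<eta> = min 1 ((a - Re w) / 2)"
    have \<eta>: "\<eta> > 0" "\<eta> \<le> 1" and \<eta>_le: "\<eta> \<le> (a - Re w) / 2"
      using lt by (auto simp: \<eta>_def min_def)
    define s where "s = (1 - \<eta>\<^sup>2 / 16)"
    define t where "t = (1 - \<eta>\<^sup>2 / 4)"
    define \<omega> where "\<omega> z = (cmod ((1 + cnj w * z) / 2))\<^sup>2" for z
    have \<omega>: "\<omega> z = 1 - (cmod (z - w))\<^sup>2 / 4" if "cmod z = 1" for z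
    proof -
      have *: "(Re z)\<^sup>2 + (Im z)\<^sup>2 = 1" "(Re w)\<^sup>2 + (Im w)\<^sup>2 = 1"
        using that w1 by (simp_all add: cmod_def)
      have A: "(cmod (1 + cnj w * z))\<^sup>2 = 1 + 2 * (Re w * Re z + Im w * Im z)
          + ((Re w)\<^sup>2 + (Im w)\<^sup>2) * ((Re z)\<^sup>2 + (Im z)\<^sup>2)"
        unfolding cmod_power2 by (simp add: power2_eq_square algebra_simps)
      have B: "(cmod (z - w))\<^sup>2 = ((Re z)\<^sup>2 + (Im z)\<^sup>2) + ((Re w)\<^sup>2 + (Im w)\<^sup>2)
          - 2 * (Re w * Re z + Im w * Im z)"
        unfolding cmod_power2 by (simp add: power2_eq_square algebra_simps)
      show ?thesis
        unfolding \<omega>_def norm_divide power_divide A B * by (simp add: field_simps)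
    qed
    let ?B = "ball w (\<eta> / 2) \<inter> space \<mu>"
    have Bsets: "?B \<in> sets \<mu>"
      unfolding sets_circle space_circle sets_restrict_space by auto
    have ind: "integrable \<mu> (indicator ?B :: complex \<Rightarrow> real)"
      using Bsets by (intro integrable_real_indicator) (auto simp: less_top[symmetric])
    have "emeasure \<mu> ?B > 0"
      using w \<eta> unfolding measure_support_def by auto
    then have m: "measure \<mu> ?B > 0" by (simp add: emeasure_eq_measure)
    have "\<eta>\<^sup>2 \<le> 1\<^sup>2" using \<eta> by (intro power_mono) auto
    then have t0: "t > 0" and ts: "t < s" using \<eta> by (auto simp: s_def t_def)
    have key: "\<eta> * s ^ n * measure \<mu> ?B \<le> (\<bar>a\<bar> + 1) * t ^ n" for n
    proof -
      have sn: "s ^ n \<ge> 0" using t0 ts by simp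
      define p where "p = [:1 / 2, cnj w / 2:] ^ n"
      have "(cmod (poly p z))\<^sup>2 = \<omega> z ^ n" for z
      proof -
        have "poly p z = ((1 + cnj w * z) / 2) ^ n"
          by (simp add: p_def add_divide_distrib mult.commute)
        then show ?thesis by (simp add: \<omega>_def norm_power power_mult[symmetric] mult.commute)
      qed
      then have "0 \<le> (LINT z|\<mu>. (Re z - a) * \<omega> z ^ n)" using pos[of p] by simp
      also have "\<dots> \<le> (LINT z|\<mu>. (\<bar>a\<bar> + 1) * t ^ n - \<eta> * s ^ n * indicator ?B z)"
      proof (rule integral_mono)
        show "integrable \<mu> (\<lambda>z. (Re z - a) * \<omega> z ^ n)"
          unfolding \<omega>_def by (intro integrable_continuous continuous_intros) auto
        show "integrable \<mu> (\<lambda>z. (\<bar>a\<bar> + 1) * t ^ n - \<eta> * s ^ n * indicator ?B z)"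
          by (intro Bochner_Integration.integrable_diff integrable_mult_right ind) auto
        fix z assume "z \<in> space \<mu>"
        then have z: "cmod z = 1" "z \<in> space \<mu>" by (auto simp: space_circle)
        have w0: "0 \<le> \<omega> z" by (simp add: \<omega>_def)
        have re: "Re z \<le> Re w + cmod (z - w)" using abs_Re_le_cmod[of "z - w"] by simp
        have rhs0: "0 \<le> (\<bar>a\<bar> + 1) * t ^ n" using t0 by simp
        consider "cmod (z - w) < \<eta> / 2" | "\<eta> / 2 \<le> cmod (z - w)" "cmod (z - w) < \<eta>"
          | "\<eta> \<le> cmod (z - w)" by linarith
        then show "(Re z - a) * \<omega> z ^ n \<le> (\<bar>a\<bar> + 1) * t ^ n - \<eta> * s ^ n * indicator ?B z"
        proof cases
          case 1
          have "(cmod (z - w))\<^sup>2 \<le> (\<eta> / 2)\<^sup>2" using 1 by (intro power_mono) auto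
          then have "s \<le> \<omega> z" using \<omega>[OF z(1)] by (simp add: s_def power_divide)
          then have "s ^ n \<le> \<omega> z ^ n" using t0 ts by (intro power_mono) auto
          moreover have "\<eta> \<le> a - Re z" using re 1 \<eta> \<eta>_le by argo
          ultimately have "\<eta> * s ^ n \<le> (a - Re z) * \<omega> z ^ n"
            using \<eta> sn by (intro mult_mono) auto
          moreover have "z \<in> ?B" using 1 z by (simp add: dist_norm norm_minus_commute)
          ultimately show ?thesis using rhs0 by (simp add: algebra_simps)
        next
          case 2
          have "z \<notin> ?B" using 2 by (simp add: dist_norm norm_minus_commute)
          moreover have "Re z - a \<le> 0" using re 2 \<eta> \<eta>_le by argo
          then have "(Re z - a) * \<omega> z ^ n \<le> 0" using w0 by (intro mult_nonpos_nonneg) auto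
          ultimately show ?thesis using rhs0 by simp
        next
          case 3
          have "z \<notin> ?B" using 3 \<eta> by (simp add: dist_norm norm_minus_commute)
          have "\<eta>\<^sup>2 \<le> (cmod (z - w))\<^sup>2" using 3 \<eta> by (intro power_mono) auto
          then have "\<omega> z \<le> t" using \<omega>[OF z(1)] by (simp add: t_def)
          then have "\<omega> z ^ n \<le> t ^ n" using w0 by (intro power_mono) auto
          moreover have "Re z - a \<le> \<bar>a\<bar> + 1" using abs_Re_le_cmod[of z] z by linarith
          ultimately have "(Re z - a) * \<omega> z ^ n \<le> (\<bar>a\<bar> + 1) * t ^ n"
            using w0 by (intro mult_mono) auto
          then show ?thesis using \<open>z \<notin> ?B\<close> by simp
        qed
      qed
      also have "\<dots> = (\<bar>a\<bar> + 1) * t ^ n - \<eta> * s ^ n * measure \<mu> ?B"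
        using Bsets ind by (subst Bochner_Integration.integral_diff) (auto simp: prob_space)
      finally show ?thesis by simp
    qed
    obtain n where n: "(t / s) ^ n < \<eta> * measure \<mu> ?B / (\<bar>a\<bar> + 1)"
      using real_arch_pow_inv[of "\<eta> * measure \<mu> ?B / (\<bar>a\<bar> + 1)" "t / s"] \<eta> m t0 ts by auto
    have "s ^ n > 0" using t0 ts by simp
    then have "(\<bar>a\<bar> + 1) * t ^ n < \<eta> * s ^ n * measure \<mu> ?B"
      using n by (simp add: power_divide field_simps)
    then show False using key[of n] by linarith
  qed
qed

end

section \<open>The two arcs\<close>

lemma cos_theta: "cos (theta c) = (c\<^sup>2 - 1) / (c\<^sup>2 + 1)"
  and theta_bounds: "0 \<le> theta c" "theta c \<le> pi"
proof -
  have pos: "0 < c\<^sup>2 + 1" by (simp add: add_nonneg_pos)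
  have "- 1 \<le> (c\<^sup>2 - 1) / (c\<^sup>2 + 1)" unfolding pos_le_divide_eq[OF pos] by simp
  moreover have "(c\<^sup>2 - 1) / (c\<^sup>2 + 1) \<le> 1" unfolding pos_divide_le_eq[OF pos] by simp
  ultimately show "cos (theta c) = (c\<^sup>2 - 1) / (c\<^sup>2 + 1)" "0 \<le> theta c" "theta c \<le> pi"
    unfolding theta_def by (auto intro: cos_arccos arccos_lbound arccos_ubound)
qed

lemma half_plane_subset_arcs:
  "{z \<in> unit_circle. (c\<^sup>2 - 1) / (c\<^sup>2 + 1) \<le> Re z} \<subseteq> arc1 c \<union> arc2 c"
proof
  fix z assume "z \<in> {z \<in> unit_circle. (c\<^sup>2 - 1) / (c\<^sup>2 + 1) \<le> Re z}"
  then have z: "cmod z = 1" "cos (theta c) \<le> Re z" by (auto simp: cos_theta)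
  define t where "t = Arg2pi z"
  have t: "0 \<le> t" "t < 2 * pi" "is_Arg z t" using Arg2pi[of z] by (auto simp: t_def)
  have ct: "cos (theta c) \<le> cos t" using cos_Arg2pi[of z] z by (simp add: t_def)
  show "z \<in> arc1 c \<union> arc2 c"
  proof (cases "t \<le> pi")
    case True
    then have "t \<le> theta c"
      using ct t theta_bounds[of c] cos_mono_le_eq[of "theta c" t] by simp
    then show ?thesis using t z unfolding arc1_def by auto
  next
    case False
    have "cos (2 * pi - t) = cos t" by (simp add: cos_diff)
    then have "2 * pi - t \<le> theta c"
      using ct t False theta_bounds[of c] cos_mono_le_eq[of "theta c" "2 * pi - t"] by simp
    then have "2 * pi - theta c \<le> t" by simp
    then show ?thesis using t z unfolding arc2_def by auto
  qed
qed

lemma tau_alternating: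
  assumes "\<And>n. n \<ge> 1 \<Longrightarrow> cs n = (-1) ^ n * c"
  shows "tau cs n = (if even n then 1 else (1 + \<i> * of_real c) / (1 - \<i> * of_real c))"
proof (induction n)
  case 0
  show ?case by (simp add: tau_def)
next
  case (Suc n)
  have nz: "1 + \<i> * of_real c \<noteq> 0" "1 - \<i> * of_real c \<noteq> 0" by (auto simp: complex_eq_iff)
  have "tau cs (Suc n) = tau cs n * ((1 - \<i> * of_real (cs (Suc n))) / (1 + \<i> * of_real (cs (Suc n))))"
    by (simp add: tau_def)
  then show ?case using Suc nz assms[of "Suc n"] by auto
qed

theorem theorem3p3:
  fixes c :: real and cs d :: "nat \<Rightarrow> real" and \<mu> :: "complex measure"
  assumes "\<And>n. n \<ge> 1 \<Longrightarrow> cs n = (-1) ^ n * c"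
    and "positive_chain_sequence d"
    and "associated_measure cs d \<mu>"
  shows "measure_support \<mu> \<subseteq> arc1 c \<union> arc2 c"
proof -
  interpret circle_measure \<mu>
    using assms(3) by unfold_locales (simp add: associated_measure_def)
  define s where "s = sqrt (1 + c\<^sup>2)"
  \<comment> \<open>This rotation removes the argument of the common denominator \<open>1 + \<i> * c\<close> of all \<open>\<alpha>\<^sub>n\<close>.\<close>
  define \<epsilon> where "\<epsilon> = csqrt ((1 + \<i> * c) / s)"
  define \<kappa> where "\<kappa> = 2 * c / s"
  have s2: "s\<^sup>2 = 1 + c\<^sup>2" by (simp add: s_def)
  have s: "s > 0" by (simp add: s_def add_pos_nonneg)
  have \<epsilon>2: "\<epsilon>\<^sup>2 = (1 + \<i> * c) / s" by (simp add: \<epsilon>_def)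
  have "cmod (1 + \<i> * c) = s" by (simp add: cmod_def s_def)
  then have "(cmod \<epsilon>)\<^sup>2 = 1"
    using s unfolding norm_power[symmetric] \<epsilon>2 by (simp add: norm_divide)
  then have \<epsilon>1: "cmod \<epsilon> = 1"
    by (simp add: power2_eq_1_iff) (metis norm_ge_zero neg_0_le_iff_le not_one_le_zero)
  have nz: "1 + \<i> * of_real c \<noteq> 0" "1 - \<i> * of_real c \<noteq> 0" by (auto simp: complex_eq_iff)
  have Im_\<alpha>: "Im (\<epsilon>\<^sup>2 * verblunsky \<mu> n) = (-1) ^ n * \<kappa> / 2" for n
  proof -
    define m where "m = minimal_parameters d (Suc n)"
    have v: "verblunsky \<mu> n = cnj (tau cs n) *
        ((1 - 2 * of_real m - \<i> * of_real (cs (Suc n))) / (1 - \<i> * of_real (cs (Suc n))))"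
      using assms(3) unfolding associated_measure_def m_def by (metis diff_Suc_1 le_add1 plus_1_eq_Suc)
    have tau: "tau cs n = (if even n then 1 else (1 + \<i> * of_real c) / (1 - \<i> * of_real c))"
      using assms(1) by (rule tau_alternating)
    have "verblunsky \<mu> n = (1 - 2 * m + \<i> * ((-1) ^ n * c)) / (1 + \<i> * c)"
      unfolding v using tau assms(1)[of "Suc n"] nz by (cases "even n") simp_all
    then have "\<epsilon>\<^sup>2 * verblunsky \<mu> n = (1 - 2 * m + \<i> * ((-1) ^ n * c)) / s"
      unfolding \<epsilon>2 using nz by simp
    also have "\<dots> = Complex ((1 - 2 * m) / s) ((-1) ^ n * c / s)"
      by (cases "even n") (simp_all add: complex_eq_iff)
    finally show ?thesis by (simp add: \<kappa>_def)
  qed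
  have "0 \<le> (LINT z|\<mu>. (Re z - (c\<^sup>2 - 1) / (c\<^sup>2 + 1)) * (cmod (poly p z))\<^sup>2)" for p
  proof -
    let ?f = "\<lambda>z. (cmod (poly p z))\<^sup>2"
    let ?a = "(c\<^sup>2 - 1) / (c\<^sup>2 + 1)"
    have int: "integrable \<mu> (\<lambda>z. (cmod (1 + z))\<^sup>2 * ?f z)" "integrable \<mu> ?f"
      by (intro integrable_continuous continuous_intros)+
    have "Im (\<epsilon>\<^sup>2) = \<kappa> / 2" unfolding \<epsilon>2 by (simp add: \<kappa>_def)
    then have "\<kappa>\<^sup>2 * (LINT z|\<mu>. ?f z) \<le> (LINT z|\<mu>. (cmod (1 + z))\<^sup>2 * ?f z)"
      by (rule verblunsky_spectral_gap[OF \<epsilon>1 _ Im_\<alpha>])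
    then have "0 \<le> (LINT z|\<mu>. (cmod (1 + z))\<^sup>2 * ?f z - \<kappa>\<^sup>2 * ?f z)"
      using int by simp
    also have "\<dots> = (LINT z|\<mu>. 2 * ((Re z - ?a) * ?f z))"
    proof (rule integral_circle_cong)
      fix z :: complex assume "cmod z = 1"
      then have "(Re z)\<^sup>2 + (Im z)\<^sup>2 = 1" by (simp add: cmod_def)
      then have 1: "(cmod (1 + z))\<^sup>2 = 2 + 2 * Re z"
        unfolding cmod_power2 by (simp add: power2_eq_square algebra_simps)
      have "c\<^sup>2 + 1 \<noteq> 0" by (smt (verit) zero_le_power2)
      then have 2: "\<kappa>\<^sup>2 = 2 + 2 * ?a"
        unfolding \<kappa>_def power_divide s2 by (simp add: field_simps)
      show "(cmod (1 + z))\<^sup>2 * ?f z - \<kappa>\<^sup>2 * ?f z = 2 * ((Re z - ?a) * ?f z)"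
        unfolding 1 2 by (simp add: algebra_simps)
    qed
    finally show ?thesis by simp
  qed
  then show ?thesis
    using support_subset_half_plane half_plane_subset_arcs by blast
qed

end
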